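(* Suppose that the following assumptions hold. (1) (Balanced panel of groups) $N_{g,t}>0$ for all $(g,t)\in\{1,\dots,G\}\times\{1,\dots,T\}$. (2) (Sharp design) $D_{i,g,t}=D_{g,t}$ for all $(g,t)$ and all $i\in\{1,\dots,N_{g,t}\}$. (3) (Strong exogeneity for $Y(0)$ and $Y(1)$) For each $d\in\{0,1\}$, all $g\in\{1,\dots,G\}$ and all $t\in\{2,\dots,T\}$, $E(Y_{g,t}(d)-Y_{g,t-1}(d)\mid D_{g,1},\dots,D_{g,T})=E(Y_{g,t}(d)-Y_{g,t-1}(d))$. (4) (Common trends for $Y(0)$ and $Y(1)$) For each $d\in\{0,1\}$ and every $t\in\{2,\dots,T\}$, $E(Y_{g,t}(d)-Y_{g,t-1}(d))$ does not vary across $g$. (5) (Existence of stable groups) For all $t\in\{2,\dots,T\}$: (i) if there is at least one $g$ with $D_{g,t-1}=0$ and $D_{g,t}=1$, then there exists at least one $g'\ne g$ with $D_{g',t-1}=D_{g',t}=0$; (ii) if there is at least one $g$ with $D_{g,t-1}=1$ and $D_{g,t}=0$, then there exists at least one $g'\neq g$ with $D_{g',t-1}=D_{g',t}=1$. (6) (Mean independence between a group's outcome and other groups' treatments) For all $g$ and $t$, $E(Y_{g,t}(0)\mid\boldsymbol D)=E(Y_{g,t}(0)\mid\boldsymbol D_g)$ and $E(Y_{g,t}(1)\mid\boldsymbol D)=E(Y_{g,t}(1)\mid\boldsymbol D_g)$. Then $E[\mathrm{DID}_{\mathrm M}]=\delta^S$.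
   Context: Setting. There are $G$ groups and $T\geq 2$ periods; $N_{g,t}$ is the (non-random) number of observations in cell $(g,t)\in\{1,\dots,G\}\times\{1,\dots,T\}$. Observation $i\in\{1,\dots,N_{g,t}\}$ of cell $(g,t)$ has a binary treatment $D_{i,g,t}\in\{0,1\}$, potential outcomes $Y_{i,g,t}(0),Y_{i,g,t}(1)$ and observed outcome $Y_{i,g,t}=Y_{i,g,t}(D_{i,g,t})$. Treatments and potential outcomes are random variables, and potential outcomes have finite expectations. Cell averages: $D_{g,t}=\frac1{N_{g,t}}\sum_i D_{i,g,t}$, $Y_{g,t}(d)=\frac1{N_{g,t}}\sum_i Y_{i,g,t}(d)$ for $d\in\{0,1\}$, $Y_{g,t}=\frac1{N_{g,t}}\sum_i Y_{i,g,t}$. $\boldsymbol D_g=(D_{g,1},\dots,D_{g,T})$ and $\boldsymbol D=(D_{g,t})_{(g,t)\in\{1,\dots,G\}\times\{1,\dots,T\}}$. Parameter. $N_S=\sum_{(g,t):t\ge2,\,D_{g,t}\ne D_{g,t-1}}N_{g,t}$, assumed positive (almost surely), and $$\delta^S=E\left[\frac1{N_S}\sum_{(i,g,t):t\ge2,\,D_{g,t}\neq D_{g,t-1}}[Y_{i,g,t}(1)-Y_{i,g,t}(0)]\right].$$ Estimator. For $t\in\{2,\dots,T\}$ and $(d,d')\in\{0,1\}^2$, $N_{d,d',t}=\sum_{g:D_{g,t}=d,\,D_{g,t-1}=d'}N_{g,t}$. Let $$\mathrm{DID}_{+,t}=\sum_{g:D_{g,t}=1,D_{g,t-1}=0}\frac{N_{g,t}}{N_{1,0,t}}(Y_{g,t}-Y_{g,t-1})-\sum_{g:D_{g,t}=D_{g,t-1}=0}\frac{N_{g,t}}{N_{0,0,t}}(Y_{g,t}-Y_{g,t-1}),$$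 $$\mathrm{DID}_{-,t}=\sum_{g:D_{g,t}=D_{g,t-1}=1}\frac{N_{g,t}}{N_{1,1,t}}(Y_{g,t}-Y_{g,t-1})-\sum_{g:D_{g,t}=0,D_{g,t-1}=1}\frac{N_{g,t}}{N_{0,1,t}}(Y_{g,t}-Y_{g,t-1}),$$ with the conventions $\mathrm{DID}_{+,t}=0$ if there is no group with $D_{g,t}=1,D_{g,t-1}=0$ or no group with $D_{g,t}=D_{g,t-1}=0$, and $\mathrm{DID}_{-,t}=0$ if there is no group with $D_{g,t}=D_{g,t-1}=1$ or no group with $D_{g,t}=0,D_{g,t-1}=1$. Finally $$\mathrm{DID}_{\mathrm M}=\sum_{t=2}^T\left(\frac{N_{1,0,t}}{N_S}\mathrm{DID}_{+,t}+\frac{N_{0,1,t}}{N_S}\mathrm{DID}_{-,t}\right).$$ *)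

theory Defs
  imports "HOL-Probability.Probability"
begin

text \<open>
  Groups are numbered \<open>1..G\<close>, periods \<open>1..T\<close>, and the observations of cell \<open>(g,t)\<close> are
  numbered \<open>1..N g t\<close>. Treatments \<open>D i g t :: 'a \<Rightarrow> nat\<close> take the values 0 and 1, and
  \<open>Y i g t d :: 'a \<Rightarrow> real\<close> is the potential outcome under treatment \<open>d\<close>, which only matters
  for \<open>d \<in> {0,1}\<close>.
\<close>

definition observed ::
  "(nat \<Rightarrow> nat \<Rightarrow> nat \<Rightarrow> 'a \<Rightarrow> nat) \<Rightarrow> (nat \<Rightarrow> nat \<Rightarrow> nat \<Rightarrow> nat \<Rightarrow> 'a \<Rightarrow> real) \<Rightarrow>
    nat \<Rightarrow> nat \<Rightarrow> nat \<Rightarrow> 'a \<Rightarrow> real" where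
  "observed D Y i g t \<omega> = Y i g t (D i g t \<omega>) \<omega>"

definition cell_mean ::
  "(nat \<Rightarrow> nat \<Rightarrow> nat) \<Rightarrow> (nat \<Rightarrow> nat \<Rightarrow> nat \<Rightarrow> 'a \<Rightarrow> real) \<Rightarrow> nat \<Rightarrow> nat \<Rightarrow> 'a \<Rightarrow> real" where
  "cell_mean N X g t \<omega> = (\<Sum>i=1..N g t. X i g t \<omega>) / real (N g t)"

abbreviation cell_treatment ::
  "(nat \<Rightarrow> nat \<Rightarrow> nat) \<Rightarrow> (nat \<Rightarrow> nat \<Rightarrow> nat \<Rightarrow> 'a \<Rightarrow> nat) \<Rightarrow> nat \<Rightarrow> nat \<Rightarrow> 'a \<Rightarrow> real" where
  "cell_treatment N D \<equiv> cell_mean N (\<lambda>i g t \<omega>. real (D i g t \<omega>))"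

abbreviation cell_potential ::
  "(nat \<Rightarrow> nat \<Rightarrow> nat) \<Rightarrow> (nat \<Rightarrow> nat \<Rightarrow> nat \<Rightarrow> nat \<Rightarrow> 'a \<Rightarrow> real) \<Rightarrow> nat \<Rightarrow>
    nat \<Rightarrow> nat \<Rightarrow> 'a \<Rightarrow> real" where
  "cell_potential N Y d \<equiv> cell_mean N (\<lambda>i g t. Y i g t d)"

abbreviation cell_outcome ::
  "(nat \<Rightarrow> nat \<Rightarrow> nat) \<Rightarrow> (nat \<Rightarrow> nat \<Rightarrow> nat \<Rightarrow> 'a \<Rightarrow> nat) \<Rightarrow>
    (nat \<Rightarrow> nat \<Rightarrow> nat \<Rightarrow> nat \<Rightarrow> 'a \<Rightarrow> real) \<Rightarrow> nat \<Rightarrow> nat \<Rightarrow> 'a \<Rightarrow> real" where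
  "cell_outcome N D Y \<equiv> cell_mean N (observed D Y)"

text \<open>Conditional expectation of \<open>f\<close> given the real random vector \<open>(X k)\<close>, \<open>k \<in> I\<close>, that is, given
  the \<open>\<sigma>\<close>-algebra on \<open>space M\<close> that the vector generates. It is a version, so statements about it
  are to be read almost everywhere.\<close>

definition cond_exp_given ::
  "'a measure \<Rightarrow> 'k set \<Rightarrow> ('k \<Rightarrow> 'a \<Rightarrow> real) \<Rightarrow> ('a \<Rightarrow> real) \<Rightarrow> 'a \<Rightarrow> real" where
  "cond_exp_given M I X f =
     real_cond_exp M
       (vimage_algebra (space M) (\<lambda>\<omega>. \<lambda>k\<in>I. X k \<omega>) (\<Pi>\<^sub>M k\<in>I. borel)) f"

text \<open>From here on \<open>D\<close> and \<open>Y\<close> are the realised cell averages \<open>D\<^bsub>g,t\<^esub>\<close> and \<open>Y\<^bsub>g,t\<^esub>\<close>: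
  the estimator is a function of these data only.\<close>

definition switching_cells :: "nat \<Rightarrow> nat \<Rightarrow> (nat \<Rightarrow> nat \<Rightarrow> real) \<Rightarrow> (nat \<times> nat) set" where
  "switching_cells G T D = {(g, t). g \<in> {1..G} \<and> t \<in> {2..T} \<and> D g t \<noteq> D g (t - 1)}"

definition N_switch :: "nat \<Rightarrow> nat \<Rightarrow> (nat \<Rightarrow> nat \<Rightarrow> nat) \<Rightarrow> (nat \<Rightarrow> nat \<Rightarrow> real) \<Rightarrow> nat" where
  "N_switch G T N D = (\<Sum>(g, t)\<in>switching_cells G T D. N g t)"

definition trans_groups :: "nat \<Rightarrow> (nat \<Rightarrow> nat \<Rightarrow> real) \<Rightarrow> real \<Rightarrow> real \<Rightarrow> nat \<Rightarrow> nat set" where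
  "trans_groups G D d d' t = {g \<in> {1..G}. D g t = d \<and> D g (t - 1) = d'}"

definition N_trans ::
  "nat \<Rightarrow> (nat \<Rightarrow> nat \<Rightarrow> nat) \<Rightarrow> (nat \<Rightarrow> nat \<Rightarrow> real) \<Rightarrow> real \<Rightarrow> real \<Rightarrow> nat \<Rightarrow> nat" where
  "N_trans G N D d d' t = (\<Sum>g\<in>trans_groups G D d d' t. N g t)"

definition mean_change ::
  "nat \<Rightarrow> (nat \<Rightarrow> nat \<Rightarrow> nat) \<Rightarrow> (nat \<Rightarrow> nat \<Rightarrow> real) \<Rightarrow> (nat \<Rightarrow> nat \<Rightarrow> real) \<Rightarrow>
    real \<Rightarrow> real \<Rightarrow> nat \<Rightarrow> real" where
  "mean_change G N D Y d d' t =
     (\<Sum>g\<in>trans_groups G D d d' t.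
        real (N g t) / real (N_trans G N D d d' t) * (Y g t - Y g (t - 1)))"

definition DID_plus ::
  "nat \<Rightarrow> (nat \<Rightarrow> nat \<Rightarrow> nat) \<Rightarrow> (nat \<Rightarrow> nat \<Rightarrow> real) \<Rightarrow> (nat \<Rightarrow> nat \<Rightarrow> real) \<Rightarrow> nat \<Rightarrow> real" where
  "DID_plus G N D Y t =
     (if trans_groups G D 1 0 t = {} \<or> trans_groups G D 0 0 t = {} then 0
      else mean_change G N D Y 1 0 t - mean_change G N D Y 0 0 t)"

definition DID_minus ::
  "nat \<Rightarrow> (nat \<Rightarrow> nat \<Rightarrow> nat) \<Rightarrow> (nat \<Rightarrow> nat \<Rightarrow> real) \<Rightarrow> (nat \<Rightarrow> nat \<Rightarrow> real) \<Rightarrow> nat \<Rightarrow> real" where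
  "DID_minus G N D Y t =
     (if trans_groups G D 1 1 t = {} \<or> trans_groups G D 0 1 t = {} then 0
      else mean_change G N D Y 1 1 t - mean_change G N D Y 0 1 t)"

definition DID_M ::
  "nat \<Rightarrow> nat \<Rightarrow> (nat \<Rightarrow> nat \<Rightarrow> nat) \<Rightarrow> (nat \<Rightarrow> nat \<Rightarrow> real) \<Rightarrow> (nat \<Rightarrow> nat \<Rightarrow> real) \<Rightarrow> real" where
  "DID_M G T N D Y =
     (\<Sum>t=2..T.
        real (N_trans G N D 1 0 t) / real (N_switch G T N D) * DID_plus G N D Y t
      + real (N_trans G N D 0 1 t) / real (N_switch G T N D) * DID_minus G N D Y t)"

text \<open>Here \<open>D\<close> and \<open>Y\<close> are again the observation-level treatments and potential outcomes.\<close>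

definition delta_S ::
  "'a measure \<Rightarrow> nat \<Rightarrow> nat \<Rightarrow> (nat \<Rightarrow> nat \<Rightarrow> nat) \<Rightarrow> (nat \<Rightarrow> nat \<Rightarrow> nat \<Rightarrow> 'a \<Rightarrow> nat) \<Rightarrow>
    (nat \<Rightarrow> nat \<Rightarrow> nat \<Rightarrow> nat \<Rightarrow> 'a \<Rightarrow> real) \<Rightarrow> real" where
  "delta_S M G T N D Y =
     (\<integral>\<omega>. 1 / real (N_switch G T N (\<lambda>g t. cell_treatment N D g t \<omega>)) *
        (\<Sum>(g, t)\<in>switching_cells G T (\<lambda>g t. cell_treatment N D g t \<omega>).
           \<Sum>i=1..N g t. Y i g t 1 \<omega> - Y i g t 0 \<omega>) \<partial>M)"

end

theory Submission
  imports Defs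
begin

text \<open>
  Write \<open>U\<^sub>d\<close> for the change of \<open>Y(d)\<close> between two consecutive periods. Almost surely, \<open>DID\<^sub>M\<close> is the
  average effect over the switching cells plus a linear combination of the \<open>U\<^sub>0\<close> and \<open>U\<^sub>1\<close> whose
  coefficients are functions of the treatments alone and, for each \<open>d\<close> and \<open>t\<close>, sum to zero over the
  groups. Exogeneity and mean independence make the conditional mean of \<open>U\<^sub>d\<close> given all treatments a
  constant, which by common trends is the same for all groups. So the linear combination has
  expectation zero. Since treatments are binary, the treatment vector has finite range, which makes
  every function of it measurable and bounded.
\<close>

section \<open>Random variables with finite range\<close>

lemma simple_function_binary:
  fixes D :: "'a \<Rightarrow> nat"
  assumes D: "D \<in> M \<rightarrow>\<^sub>M count_space UNIV" and bin: "\<And>\<omega>. \<omega> \<in> space M \<Longrightarrow> D \<omega> \<in> {0, 1}"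
  shows "simple_function M D"
proof -
  have "D ` space M \<subseteq> {0, 1}"
    using bin by (intro image_subsetI)
  then have "finite (D ` space M)"
    by (rule finite_subset) simp
  moreover have "D -` {x} \<inter> space M \<in> sets M" for x
    using D by (rule measurable_sets) simp
  ultimately show ?thesis
    unfolding simple_function_def by blast
qed

lemma simple_function_cell_treatment:
  assumes "\<And>i. i \<in> {1..N g t} \<Longrightarrow> simple_function M (D i g t)"
  shows "simple_function M (cell_treatment N D g t)"
proof -
  have "simple_function M (\<lambda>\<omega>. \<Sum>i=1..N g t. real (D i g t \<omega>))"
    using assms by (intro simple_function_sum simple_function_compose1[where g = real])
  then have "simple_function M (\<lambda>\<omega>. (\<Sum>i=1..N g t. real (D i g t \<omega>)) / real (N g t))"
    by (rule simple_function_div) (rule simple_function_const)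
  then show ?thesis
    by (simp add: cell_mean_def[abs_def])
qed

text \<open>The selected function is a finite sum of the \<open>f z\<close>, each cut down to the
  event \<open>Z = z\<close>. Hence nothing is asked of how \<open>f z\<close> depends on
  \<open>z\<close>, which later admits arbitrary functions of the treatments as
  coefficients.\<close>

lemma integrable_finite_selection:
  fixes f :: "'b \<Rightarrow> 'a \<Rightarrow> real"
  assumes Z: "Z \<in> M \<rightarrow>\<^sub>M count_space R" and R: "finite R"
    and f: "\<And>z. z \<in> R \<Longrightarrow> integrable M (f z)"
  shows "integrable M (\<lambda>\<omega>. f (Z \<omega>) \<omega>)"
proof -
  have "integrable M (\<lambda>\<omega>. \<Sum>z\<in>R. indicator (Z -` {z} \<inter> space M) \<omega> * f z \<omega>)"
  proof (rule Bochner_Integration.integrable_sum)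
    fix z assume z: "z \<in> R"
    then have "Z -` {z} \<inter> space M \<in> sets M"
      using Z by (intro measurable_sets) auto
    then show "integrable M (\<lambda>\<omega>. indicator (Z -` {z} \<inter> space M) \<omega> * f z \<omega>)"
      using integrable_mult_indicator[OF _ f[OF z]] by simp
  qed
  moreover have "f (Z \<omega>) \<omega> = (\<Sum>z\<in>R. indicator (Z -` {z} \<inter> space M) \<omega> * f z \<omega>)"
    if "\<omega> \<in> space M" for \<omega>
  proof -
    have "(\<Sum>z\<in>R. indicator (Z -` {z} \<inter> space M) \<omega> * f z \<omega>) = (\<Sum>z\<in>R. if z = Z \<omega> then f z \<omega> else 0)"
      using that by (intro sum.cong) (auto simp: indicator_def)
    also have "\<dots> = f (Z \<omega>) \<omega>"
      using R measurable_space[OF Z that] by simp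
    finally show ?thesis by simp
  qed
  ultimately show ?thesis
    by (subst Bochner_Integration.integrable_cong[OF refl]) auto
qed

lemma finite_range_restrict:
  assumes "finite I" and "\<And>k. k \<in> I \<Longrightarrow> finite (X k ` S)"
  shows "finite ((\<lambda>\<omega>. \<lambda>k\<in>I. X k \<omega>) ` S)"
  by (rule finite_subset[OF _ finite_PiE[OF assms]]) auto

text \<open>A level set of the vector is a finite intersection of level sets of its coordinates. The
  target is discrete so that every function of the vector becomes measurable by composition.\<close>

lemma measurable_restrict_count_space:
  fixes X :: "'k \<Rightarrow> 'a \<Rightarrow> real"
  assumes I: "finite I" and X: "\<And>k. k \<in> I \<Longrightarrow> X k \<in> borel_measurable M"
    and fin: "\<And>k. k \<in> I \<Longrightarrow> finite (X k ` space M)"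
  defines "Z \<equiv> \<lambda>\<omega>. \<lambda>k\<in>I. X k \<omega>"
  shows "Z \<in> M \<rightarrow>\<^sub>M count_space (Z ` space M)"
proof -
  have "Z -` {z} \<inter> space M \<in> sets M" if "z \<in> Z ` space M" for z
  proof -
    have "Z -` {z} \<inter> space M = {\<omega>\<in>space M. \<forall>k\<in>I. X k \<omega> = z k}"
    proof -
      \<comment> \<open>Both \<open>Z \<omega>\<close> and \<open>z\<close> are
        \<open>undefined\<close> outside \<open>I\<close>, so their equality reduces to equality on
        \<open>I\<close>.\<close>
      have "z \<in> extensional I"
        using that by (auto simp: Z_def)
      then have "Z \<omega> = z \<longleftrightarrow> (\<forall>k\<in>I. X k \<omega> = z k)" for \<omega>
        unfolding Z_def by (auto simp: extensional_def fun_eq_iff)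
      then show ?thesis by auto
    qed
    also have "\<dots> \<in> sets M"
      using I X by measurable
    finally show ?thesis .
  qed
  moreover have "finite (Z ` space M)"
    unfolding Z_def using I fin by (rule finite_range_restrict)
  ultimately show ?thesis
    by (simp add: measurable_count_space_eq2)
qed

section \<open>Conditioning on a random vector\<close>

abbreviation generated_algebra ::
  "'a measure \<Rightarrow> 'k set \<Rightarrow> ('k \<Rightarrow> 'a \<Rightarrow> real) \<Rightarrow> 'a measure" where
  "generated_algebra M I X \<equiv>
     vimage_algebra (space M) (\<lambda>\<omega>. \<lambda>k\<in>I. X k \<omega>) (\<Pi>\<^sub>M k\<in>I. borel)"

lemma measurable_generated_algebra:
  assumes "k \<in> I"
  shows "X k \<in> borel_measurable (generated_algebra M I X)"
proof -
  have "(\<lambda>\<omega>. \<lambda>k\<in>I. X k \<omega>) \<in> generated_algebra M I X \<rightarrow>\<^sub>M (\<Pi>\<^sub>M k\<in>I. borel)"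
    by (rule measurable_vimage_algebra1) (auto simp: space_PiM)
  from measurable_component_singleton[OF assms, THEN measurable_compose[OF this]]
  show ?thesis
    using assms by simp
qed

lemma (in prob_space) sigma_finite_subalgebra_generated:
  assumes "\<And>k. k \<in> I \<Longrightarrow> X k \<in> borel_measurable M"
  shows "sigma_finite_subalgebra M (generated_algebra M I X)"
proof -
  have "(\<lambda>\<omega>. \<lambda>k\<in>I. X k \<omega>) \<in> M \<rightarrow>\<^sub>M (\<Pi>\<^sub>M k\<in>I. borel)"
    using assms by (rule measurable_restrict)
  then have "subalgebra M (generated_algebra M I X)"
    unfolding subalgebra_def by (auto simp: sets_vimage_algebra2 space_PiM measurable_def)
  then interpret finite_measure_subalgebra M "generated_algebra M I X"
    by unfold_locales
  show ?thesis
    by (rule sigma_finite_subalgebra_axioms)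
qed

text \<open>Exogeneity concerns changes between periods, whereas mean independence concerns levels;
  linearity connects the two.\<close>

lemma (in prob_space) cond_exp_given_diff:
  assumes "\<And>k. k \<in> I \<Longrightarrow> X k \<in> borel_measurable M"
    and "integrable M f" "integrable M g"
  shows "AE \<omega> in M. cond_exp_given M I X (\<lambda>\<omega>. f \<omega> - g \<omega>) \<omega>
    = cond_exp_given M I X f \<omega> - cond_exp_given M I X g \<omega>"
proof -
  interpret sigma_finite_subalgebra M "generated_algebra M I X"
    using assms(1) by (rule sigma_finite_subalgebra_generated)
  show ?thesis
    unfolding cond_exp_given_def using assms(2,3) by (rule real_cond_exp_diff)
qed

text \<open>Pull-out property: a function of the conditioning vector passes through the conditional
  expectation, after which \<open>f\<close> may be replaced by the constant \<open>c\<close>. Finite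
  range permits an arbitrary \<open>\<phi>\<close>.\<close>

lemma (in prob_space) expectation_weighted_if_mean_independent:
  fixes \<phi> :: "('k \<Rightarrow> real) \<Rightarrow> real"
  assumes I: "finite I" and X: "\<And>k. k \<in> I \<Longrightarrow> X k \<in> borel_measurable M"
    and fin: "\<And>k. k \<in> I \<Longrightarrow> finite (X k ` space M)"
    and f: "integrable M f" and ae: "AE \<omega> in M. cond_exp_given M I X f \<omega> = c"
  shows "(\<integral>\<omega>. \<phi> (\<lambda>k\<in>I. X k \<omega>) * f \<omega> \<partial>M) = c * (\<integral>\<omega>. \<phi> (\<lambda>k\<in>I. X k \<omega>) \<partial>M)"
proof -
  let ?F = "generated_algebra M I X" and ?Z = "\<lambda>\<omega>. \<lambda>k\<in>I. X k \<omega>"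
  interpret sigma_finite_subalgebra M ?F
    using X by (rule sigma_finite_subalgebra_generated)
  \<comment> \<open>Pulling \<open>\<phi>\<close> out requires measurability for the generated
    algebra itself, not merely for \<open>M\<close>.\<close>
  have "?Z \<in> ?F \<rightarrow>\<^sub>M count_space (?Z ` space ?F)"
    using I measurable_generated_algebra fin by (intro measurable_restrict_count_space) auto
  then have \<phi>: "(\<lambda>\<omega>. \<phi> (?Z \<omega>)) \<in> borel_measurable ?F"
    by (rule measurable_compose) simp
  have "integrable M (\<lambda>\<omega>. \<phi> (?Z \<omega>) * f \<omega>)"
    by (rule integrable_finite_selection[where f = "\<lambda>z \<omega>. \<phi> z * f \<omega>"])
      (use I X fin f in \<open>auto intro: measurable_restrict_count_space finite_range_restrict\<close>)
  then have "(\<integral>\<omega>. \<phi> (?Z \<omega>) * f \<omega> \<partial>M) = (\<integral>\<omega>. \<phi> (?Z \<omega>) * real_cond_exp M ?F f \<omega> \<partial>M)"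
    using f \<phi> by (intro real_cond_exp_intg(2)[symmetric]) auto
  also have "\<dots> = (\<integral>\<omega>. \<phi> (?Z \<omega>) * c \<partial>M)"
    using ae measurable_from_subalg[OF subalg \<phi>] unfolding cond_exp_given_def
    by (intro integral_cong_AE) auto
  finally show ?thesis
    by (simp add: mult.commute)
qed

section \<open>Algebra of the estimator for fixed treatments and outcomes\<close>

lemma trans_groups_cong:
  assumes "\<And>g t. g \<in> {1..G} \<Longrightarrow> t \<in> {1..T} \<Longrightarrow> D g t = D' g t" and "t \<in> {2..T}"
  shows "trans_groups G D d d' t = trans_groups G D' d d' t"
proof -
  have "t \<in> {1..T}" "t - 1 \<in> {1..T}"
    using assms(2) by auto
  then have "D g t = D' g t" "D g (t - 1) = D' g (t - 1)" if "g \<in> {1..G}" for g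
    using assms(1) that by blast+
  then show ?thesis
    by (auto simp: trans_groups_def)
qed

lemma switching_cells_cong:
  assumes "\<And>g t. g \<in> {1..G} \<Longrightarrow> t \<in> {1..T} \<Longrightarrow> D g t = D' g t"
  shows "switching_cells G T D = switching_cells G T D'"
proof -
  have "D g t = D' g t" "D g (t - 1) = D' g (t - 1)" if "g \<in> {1..G}" "t \<in> {2..T}" for g t
    using that by (auto intro!: assms)
  then show ?thesis
    by (auto simp: switching_cells_def)
qed

text \<open>The estimator reads treatments only inside the panel, because \<open>t\<close> starts at
  2 and \<open>t - 1\<close> is then a valid period. The treatment vector used later is
  \<open>undefined\<close> outside the panel, so agreement can be expected only inside it.\<close>

lemma DID_M_cong:
  assumes "\<And>g t. g \<in> {1..G} \<Longrightarrow> t \<in> {1..T} \<Longrightarrow> D g t = D' g t"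
  shows "DID_M G T N D Y = DID_M G T N D' Y"
  unfolding DID_M_def N_trans_def N_switch_def DID_plus_def DID_minus_def mean_change_def
  using trans_groups_cong[OF assms] switching_cells_cong[OF assms]
  by (intro sum.cong) simp_all

text \<open>Treatment level \<open>d\<close> is the level from which the movers come and at which the stayers stay:
  \<open>d = 0, e = 1\<close> gives \<open>DID\<^sub>+\<close>, and \<open>d = 1, e = 0\<close> gives \<open>DID\<^sub>-\<close> up to sign.\<close>

definition contrast ::
  "nat \<Rightarrow> (nat \<Rightarrow> nat \<Rightarrow> nat) \<Rightarrow> (nat \<Rightarrow> nat \<Rightarrow> real) \<Rightarrow> real \<Rightarrow> real \<Rightarrow> nat \<Rightarrow> nat \<Rightarrow> real" where
  "contrast G N D d e t g =
     (if trans_groups G D e d t = {} \<or> trans_groups G D d d t = {} then 0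
      else real (N g t) * (of_bool (g \<in> trans_groups G D e d t)
        - real (N_trans G N D e d t) / real (N_trans G N D d d t)
            * of_bool (g \<in> trans_groups G D d d t)))"

lemma trans_groups_subset: "trans_groups G D d d' t \<subseteq> {1..G}"
  by (auto simp: trans_groups_def)

lemma finite_trans_groups [simp]: "finite (trans_groups G D d d' t)"
  by (rule finite_subset[OF trans_groups_subset]) simp

lemma sum_trans_groups:
  fixes f :: "nat \<Rightarrow> real"
  shows "(\<Sum>g\<in>trans_groups G D d d' t. f g)
    = (\<Sum>g=1..G. f g * of_bool (g \<in> trans_groups G D d d' t))"
  using trans_groups_subset[of G D d d' t]
  by (intro sum.mono_neutral_cong_left) auto

lemma N_trans_pos:
  assumes "\<And>g. g \<in> {1..G} \<Longrightarrow> N g t > 0" and "trans_groups G D d d' t \<noteq> {}"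
  shows "N_trans G N D d d' t > 0"
  unfolding N_trans_def
proof (rule sum_pos)
  show "N g t > 0" if "g \<in> trans_groups G D d d' t" for g
    using assms(1) trans_groups_subset that by blast
qed (use assms(2) in simp_all)

lemma sum_contrast_mult:
  assumes "trans_groups G D e d t \<noteq> {}" "trans_groups G D d d t \<noteq> {}"
  shows "(\<Sum>g=1..G. contrast G N D d e t g * f g) =
    (\<Sum>g\<in>trans_groups G D e d t. real (N g t) * f g)
    - real (N_trans G N D e d t) / real (N_trans G N D d d t) *
      (\<Sum>g\<in>trans_groups G D d d t. real (N g t) * f g)"
  unfolding sum_trans_groups sum_distrib_left sum_subtractf[symmetric]
  using assms by (intro sum.cong refl) (simp add: contrast_def algebra_simps)

lemma mean_change_eq:
  "mean_change G N D Y d d' t =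
    (\<Sum>g\<in>trans_groups G D d d' t. real (N g t) * (Y g t - Y g (t - 1))) / real (N_trans G N D d d' t)"
  unfolding mean_change_def sum_divide_distrib by (intro sum.cong) simp_all

text \<open>Positive cell sizes make \<open>N_trans G N D e d t\<close> positive, so it cancels the
  denominator of the movers' mean. In the degenerate case the contrast vanishes by a convention
  matching those of \<open>DID_plus\<close> and \<open>DID_minus\<close>.\<close>

lemma sum_contrast_change:
  assumes "\<And>g. g \<in> {1..G} \<Longrightarrow> N g t > 0"
  shows "(\<Sum>g=1..G. contrast G N D d e t g * (Y g t - Y g (t - 1))) =
    (if trans_groups G D e d t = {} \<or> trans_groups G D d d t = {} then 0
     else real (N_trans G N D e d t) * (mean_change G N D Y e d t - mean_change G N D Y d d t))"
proof (cases "trans_groups G D e d t = {} \<or> trans_groups G D d d t = {}")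
  case True
  then show ?thesis by (auto simp: contrast_def)
next
  case False
  then have "N_trans G N D e d t > 0"
    using assms by (intro N_trans_pos) auto
  then show ?thesis
    using False sum_contrast_mult[of G D e d t N "\<lambda>g. Y g t - Y g (t - 1)"]
    by (simp add: mean_change_eq right_diff_distrib[of "real (N_trans G N D e d t)"] del: One_nat_def)
qed

text \<open>\<open>DID_minus\<close> subtracts movers from stayers while \<open>contrast\<close>
  does the opposite, hence the minus sign before the second sum.\<close>

lemma DID_M_eq_contrasts:
  assumes N: "\<And>g t. g \<in> {1..G} \<Longrightarrow> t \<in> {1..T} \<Longrightarrow> N g t > 0"
  shows "DID_M G T N D Y = 1 / real (N_switch G T N D) *
    (\<Sum>t=2..T. (\<Sum>g=1..G. contrast G N D 0 1 t g * (Y g t - Y g (t - 1)))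
      - (\<Sum>g=1..G. contrast G N D 1 0 t g * (Y g t - Y g (t - 1))))"
  unfolding DID_M_def sum_distrib_left
proof (intro sum.cong refl)
  fix t assume "t \<in> {2..T}"
  then have "\<And>g. g \<in> {1..G} \<Longrightarrow> N g t > 0"
    using N by auto
  then have "(\<Sum>g=1..G. contrast G N D d e t g * (Y g t - Y g (t - 1))) =
    (if trans_groups G D e d t = {} \<or> trans_groups G D d d t = {} then 0
     else real (N_trans G N D e d t) * (mean_change G N D Y e d t - mean_change G N D Y d d t))"
    for d e
    by (rule sum_contrast_change)
  then show "real (N_trans G N D 1 0 t) / real (N_switch G T N D) * DID_plus G N D Y t
      + real (N_trans G N D 0 1 t) / real (N_switch G T N D) * DID_minus G N D Y t
    = 1 / real (N_switch G T N D) *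
      ((\<Sum>g=1..G. contrast G N D 0 1 t g * (Y g t - Y g (t - 1)))
        - (\<Sum>g=1..G. contrast G N D 1 0 t g * (Y g t - Y g (t - 1))))"
    by (simp only:) (simp add: DID_plus_def DID_minus_def diff_divide_distrib algebra_simps)
qed

text \<open>The movers carry total weight \<open>N_trans G N D e d t\<close>, and the ratio in
  \<open>contrast\<close> rescales the stayers to the same total. This is what makes a trend shared
  by all groups cancel.\<close>

lemma sum_contrast_eq_0:
  assumes "\<And>g. g \<in> {1..G} \<Longrightarrow> N g t > 0"
  shows "(\<Sum>g=1..G. contrast G N D d e t g) = 0"
proof (cases "trans_groups G D e d t = {} \<or> trans_groups G D d d t = {}")
  case True
  then show ?thesis by (auto simp: contrast_def)
next
  case False
  then have "N_trans G N D d d t > 0"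
    using assms by (intro N_trans_pos) auto
  then show ?thesis
    using False sum_contrast_mult[of G D e d t N "\<lambda>_. 1"]
    by (simp add: N_trans_def[symmetric] of_nat_sum[symmetric] del: One_nat_def of_nat_sum)
qed

text \<open>A mover's outcome change is its change under \<open>d\<close> plus its effect
  \<open>ye - yd\<close> in period \<open>t\<close>; a stayer's is its change under \<open>d\<close>
  alone. The last assumption excludes movers without stayers, where the contrast is 0 while the sum
  of effects may not be.\<close>

lemma sum_contrast_outcome:
  assumes "d \<noteq> e"
    and "\<And>g. g \<in> {1..G} \<Longrightarrow> D g t = d \<Longrightarrow> Y g t = yd g t"
    and "\<And>g. g \<in> {1..G} \<Longrightarrow> D g t = e \<Longrightarrow> Y g t = ye g t"
    and "\<And>g. g \<in> {1..G} \<Longrightarrow> D g (t - 1) = d \<Longrightarrow> Y g (t - 1) = yd g (t - 1)"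
    and "trans_groups G D e d t \<noteq> {} \<Longrightarrow> trans_groups G D d d t \<noteq> {}"
  shows "(\<Sum>g=1..G. contrast G N D d e t g * (Y g t - Y g (t - 1))) =
    (\<Sum>g=1..G. contrast G N D d e t g * (yd g t - yd g (t - 1)))
    + (\<Sum>g\<in>trans_groups G D e d t. real (N g t) * (ye g t - yd g t))"
  unfolding sum_trans_groups sum.distrib[symmetric]
proof (intro sum.cong refl)
  fix g assume g: "g \<in> {1..G}"
  consider "g \<in> trans_groups G D e d t" | "g \<in> trans_groups G D d d t"
    | "g \<notin> trans_groups G D e d t" "g \<notin> trans_groups G D d d t"
    by blast
  then show "contrast G N D d e t g * (Y g t - Y g (t - 1)) =
    contrast G N D d e t g * (yd g t - yd g (t - 1))
    + real (N g t) * (ye g t - yd g t) * of_bool (g \<in> trans_groups G D e d t)"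
  proof cases
    case 1
    then have "g \<notin> trans_groups G D d d t" "trans_groups G D e d t \<noteq> {}"
      "Y g t = ye g t" "Y g (t - 1) = yd g (t - 1)"
      using assms(1) assms(3,4)[OF g] by (auto simp: trans_groups_def)
    then show ?thesis
      using 1 assms(5) by (simp add: contrast_def algebra_simps)
  next
    case 2
    then have "g \<notin> trans_groups G D e d t" "Y g t = yd g t" "Y g (t - 1) = yd g (t - 1)"
      using assms(1) assms(2,4)[OF g] by (auto simp: trans_groups_def)
    then show ?thesis by simp
  next
    case 3
    then show ?thesis by (simp add: contrast_def)
  qed
qed

text \<open>A binary treatment that changes goes either from 0 to 1 or from 1 to 0, and these cases
  are disjoint.\<close>

lemma sum_switching_cells:
  fixes f :: "nat \<Rightarrow> nat \<Rightarrow> real"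
  assumes "\<And>g t. g \<in> {1..G} \<Longrightarrow> t \<in> {1..T} \<Longrightarrow> D g t \<in> {0, 1}"
  shows "(\<Sum>(g, t)\<in>switching_cells G T D. f g t) =
    (\<Sum>t=2..T. (\<Sum>g\<in>trans_groups G D 1 0 t. f g t) + (\<Sum>g\<in>trans_groups G D 0 1 t. f g t))"
proof -
  have "(\<Sum>(g, t)\<in>switching_cells G T D. f g t) =
    (\<Sum>(t, g)\<in>(SIGMA t:{2..T}. {g\<in>{1..G}. D g t \<noteq> D g (t - 1)}). f g t)"
    by (rule sum.reindex_bij_witness[of _ prod.swap prod.swap]) (auto simp: switching_cells_def)
  also have "\<dots> = (\<Sum>t=2..T. \<Sum>g\<in>{g\<in>{1..G}. D g t \<noteq> D g (t - 1)}. f g t)"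
    by (subst sum.Sigma) auto
  also have "\<dots> = (\<Sum>t=2..T. (\<Sum>g\<in>trans_groups G D 1 0 t. f g t)
      + (\<Sum>g\<in>trans_groups G D 0 1 t. f g t))"
  proof (intro sum.cong refl)
    fix t assume t: "t \<in> {2..T}"
    have "D g t \<in> {0, 1}" "D g (t - 1) \<in> {0, 1}" if "g \<in> {1..G}" for g
      by (rule assms; use t that in auto)+
    then have "{g\<in>{1..G}. D g t \<noteq> D g (t - 1)} = trans_groups G D 1 0 t \<union> trans_groups G D 0 1 t"
      by (fastforce simp: trans_groups_def)
    moreover have "trans_groups G D 1 0 t \<inter> trans_groups G D 0 1 t = {}"
      by (auto simp: trans_groups_def)
    ultimately show "(\<Sum>g\<in>{g\<in>{1..G}. D g t \<noteq> D g (t - 1)}. f g t) =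
      (\<Sum>g\<in>trans_groups G D 1 0 t. f g t) + (\<Sum>g\<in>trans_groups G D 0 1 t. f g t)"
      by (simp add: sum.union_disjoint)
  qed
  finally show ?thesis .
qed

text \<open>A pointwise identity free of probability: the first term is the average effect over the
  switching cells, the second is the estimation error. Trends are arbitrary here; the error vanishes
  only in expectation.\<close>

lemma DID_M_decomposition:
  assumes N: "\<And>g t. g \<in> {1..G} \<Longrightarrow> t \<in> {1..T} \<Longrightarrow> N g t > 0"
    and D: "\<And>g t. g \<in> {1..G} \<Longrightarrow> t \<in> {1..T} \<Longrightarrow> D g t \<in> {0, 1}"
    and Y0: "\<And>g t. g \<in> {1..G} \<Longrightarrow> t \<in> {1..T} \<Longrightarrow> D g t = 0 \<Longrightarrow> Y g t = y0 g t"
    and Y1: "\<And>g t. g \<in> {1..G} \<Longrightarrow> t \<in> {1..T} \<Longrightarrow> D g t = 1 \<Longrightarrow> Y g t = y1 g t"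
    and S0: "\<And>t. t \<in> {2..T} \<Longrightarrow> trans_groups G D 1 0 t \<noteq> {} \<Longrightarrow> trans_groups G D 0 0 t \<noteq> {}"
    and S1: "\<And>t. t \<in> {2..T} \<Longrightarrow> trans_groups G D 0 1 t \<noteq> {} \<Longrightarrow> trans_groups G D 1 1 t \<noteq> {}"
  shows "DID_M G T N D Y =
    1 / real (N_switch G T N D) *
      (\<Sum>(g, t)\<in>switching_cells G T D. real (N g t) * (y1 g t - y0 g t))
    + 1 / real (N_switch G T N D) *
      (\<Sum>t=2..T. (\<Sum>g=1..G. contrast G N D 0 1 t g * (y0 g t - y0 g (t - 1)))
        - (\<Sum>g=1..G. contrast G N D 1 0 t g * (y1 g t - y1 g (t - 1))))"
proof -
  have "(\<Sum>g=1..G. contrast G N D 0 1 t g * (Y g t - Y g (t - 1)))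
      - (\<Sum>g=1..G. contrast G N D 1 0 t g * (Y g t - Y g (t - 1)))
    = ((\<Sum>g\<in>trans_groups G D 1 0 t. real (N g t) * (y1 g t - y0 g t))
      + (\<Sum>g\<in>trans_groups G D 0 1 t. real (N g t) * (y1 g t - y0 g t)))
      + ((\<Sum>g=1..G. contrast G N D 0 1 t g * (y0 g t - y0 g (t - 1)))
        - (\<Sum>g=1..G. contrast G N D 1 0 t g * (y1 g t - y1 g (t - 1))))"
    if t: "t \<in> {2..T}" for t
  proof -
    have t': "t \<in> {1..T}" "t - 1 \<in> {1..T}"
      using t by auto
    have "(\<Sum>g=1..G. contrast G N D 0 1 t g * (Y g t - Y g (t - 1))) =
      (\<Sum>g=1..G. contrast G N D 0 1 t g * (y0 g t - y0 g (t - 1)))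
      + (\<Sum>g\<in>trans_groups G D 1 0 t. real (N g t) * (y1 g t - y0 g t))"
      using t' Y0 Y1 S0[OF t] by (intro sum_contrast_outcome) auto
    moreover have "(\<Sum>g=1..G. contrast G N D 1 0 t g * (Y g t - Y g (t - 1))) =
      (\<Sum>g=1..G. contrast G N D 1 0 t g * (y1 g t - y1 g (t - 1)))
      + (\<Sum>g\<in>trans_groups G D 0 1 t. real (N g t) * (y0 g t - y1 g t))"
      using t' Y0 Y1 S1[OF t] by (intro sum_contrast_outcome) auto
    \<comment> \<open>Groups leaving treatment contribute \<open>y0 - y1\<close>, but their contrast
      is subtracted, so their effect also enters as \<open>y1 - y0\<close>.\<close>
    moreover have "(\<Sum>g\<in>trans_groups G D 0 1 t. real (N g t) * (y0 g t - y1 g t))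
      = - (\<Sum>g\<in>trans_groups G D 0 1 t. real (N g t) * (y1 g t - y0 g t))"
      by (simp add: sum_negf[symmetric] right_diff_distrib)
    ultimately show ?thesis
      by simp
  qed
  moreover have "DID_M G T N D Y = 1 / real (N_switch G T N D) *
    (\<Sum>t=2..T. (\<Sum>g=1..G. contrast G N D 0 1 t g * (Y g t - Y g (t - 1)))
      - (\<Sum>g=1..G. contrast G N D 1 0 t g * (Y g t - Y g (t - 1))))"
    using N by (rule DID_M_eq_contrasts)
  moreover have "(\<Sum>(g, t)\<in>switching_cells G T D. real (N g t) * (y1 g t - y0 g t)) =
    (\<Sum>t=2..T. (\<Sum>g\<in>trans_groups G D 1 0 t. real (N g t) * (y1 g t - y0 g t))
      + (\<Sum>g\<in>trans_groups G D 0 1 t. real (N g t) * (y1 g t - y0 g t)))"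
    using D by (rule sum_switching_cells)
  ultimately show ?thesis
    by (simp only: distrib_left[symmetric] sum.distrib[symmetric] cong: sum.cong)
qed

theorem theorem3:
  fixes M :: "'a measure"
    and G T :: nat
    and N :: "nat \<Rightarrow> nat \<Rightarrow> nat"
    and D :: "nat \<Rightarrow> nat \<Rightarrow> nat \<Rightarrow> 'a \<Rightarrow> nat"
    and Y :: "nat \<Rightarrow> nat \<Rightarrow> nat \<Rightarrow> nat \<Rightarrow> 'a \<Rightarrow> real"
  assumes "prob_space M"
    and "T \<ge> 2"
    and D_measurable: "\<And>i g t. g \<in> {1..G} \<Longrightarrow> t \<in> {1..T} \<Longrightarrow> i \<in> {1..N g t} \<Longrightarrow>
      D i g t \<in> M \<rightarrow>\<^sub>M count_space UNIV"
    and D_binary: "\<And>i g t \<omega>. g \<in> {1..G} \<Longrightarrow> t \<in> {1..T} \<Longrightarrow> i \<in> {1..N g t} \<Longrightarrow>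
      \<omega> \<in> space M \<Longrightarrow> D i g t \<omega> \<in> {0, 1}"
    and Y_integrable: "\<And>i g t d. g \<in> {1..G} \<Longrightarrow> t \<in> {1..T} \<Longrightarrow> i \<in> {1..N g t} \<Longrightarrow>
      d \<in> {0, 1} \<Longrightarrow> integrable M (Y i g t d)"
    and N_switch_pos: "AE \<omega> in M. N_switch G T N (\<lambda>g t. cell_treatment N D g t \<omega>) > 0"
    and balanced_panel: "\<And>g t. g \<in> {1..G} \<Longrightarrow> t \<in> {1..T} \<Longrightarrow> N g t > 0"
    and sharp_design: "AE \<omega> in M. \<forall>g\<in>{1..G}. \<forall>t\<in>{1..T}. \<forall>i\<in>{1..N g t}.
      real (D i g t \<omega>) = cell_treatment N D g t \<omega>"
    and strong_exogeneity: "\<And>d g t. d \<in> {0, 1} \<Longrightarrow> g \<in> {1..G} \<Longrightarrow> t \<in> {2..T} \<Longrightarrow>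
      AE \<omega> in M.
        cond_exp_given M {1..T} (\<lambda>s. cell_treatment N D g s)
          (\<lambda>\<omega>. cell_potential N Y d g t \<omega> - cell_potential N Y d g (t - 1) \<omega>) \<omega>
        = (\<integral>\<omega>. cell_potential N Y d g t \<omega> - cell_potential N Y d g (t - 1) \<omega> \<partial>M)"
    and common_trends: "\<And>d t g g'. d \<in> {0, 1} \<Longrightarrow> t \<in> {2..T} \<Longrightarrow> g \<in> {1..G} \<Longrightarrow> g' \<in> {1..G} \<Longrightarrow>
      (\<integral>\<omega>. cell_potential N Y d g t \<omega> - cell_potential N Y d g (t - 1) \<omega> \<partial>M)
      = (\<integral>\<omega>. cell_potential N Y d g' t \<omega> - cell_potential N Y d g' (t - 1) \<omega> \<partial>M)"
    and stable_groups: "AE \<omega> in M. \<forall>t\<in>{2..T}. \<forall>g\<in>{1..G}.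
      (cell_treatment N D g (t - 1) \<omega> = 0 \<and> cell_treatment N D g t \<omega> = 1 \<longrightarrow>
        (\<exists>g'\<in>{1..G}. g' \<noteq> g \<and>
          cell_treatment N D g' (t - 1) \<omega> = 0 \<and> cell_treatment N D g' t \<omega> = 0)) \<and>
      (cell_treatment N D g (t - 1) \<omega> = 1 \<and> cell_treatment N D g t \<omega> = 0 \<longrightarrow>
        (\<exists>g'\<in>{1..G}. g' \<noteq> g \<and>
          cell_treatment N D g' (t - 1) \<omega> = 1 \<and> cell_treatment N D g' t \<omega> = 1))"
    and mean_independence: "\<And>d g t. d \<in> {0, 1} \<Longrightarrow> g \<in> {1..G} \<Longrightarrow> t \<in> {1..T} \<Longrightarrow>
      AE \<omega> in M.
        cond_exp_given M ({1..G} \<times> {1..T}) (\<lambda>(h, s). cell_treatment N D h s)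
          (cell_potential N Y d g t) \<omega>
        = cond_exp_given M {1..T} (\<lambda>s. cell_treatment N D g s) (cell_potential N Y d g t) \<omega>"
  shows "(\<integral>\<omega>. DID_M G T N (\<lambda>g t. cell_treatment N D g t \<omega>)
                             (\<lambda>g t. cell_outcome N D Y g t \<omega>) \<partial>M)
         = delta_S M G T N D Y"
proof -
  interpret prob_space M by fact
  let ?X = "cell_treatment N D"
  let ?I = "{1..G} \<times> {1..T}"
  define y where "y d = cell_potential N Y d" for d
  define u where "u d g t \<omega> = y d g t \<omega> - y d g (t - 1) \<omega>" for d g t \<omega>
  \<comment> \<open>Group 1 serves as the reference; common trends carry its mean change over to
    every group.\<close>
  define \<psi> where "\<psi> d t = (\<integral>\<omega>. u d 1 t \<omega> \<partial>M)" for d t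
  \<comment> \<open>The full treatment vector, in the shape that \<open>cond_exp_given\<close>
    conditions on for the index set \<open>?I\<close>.\<close>
  define Z where "Z \<omega> = (\<lambda>k\<in>?I. (case k of (h, s) \<Rightarrow> ?X h s) \<omega>)" for \<omega>
  define R where "R = Z ` space M"
  \<comment> \<open>Treatments and outcomes are separated: freezing \<open>z\<close> leaves a finite
    linear combination of potential outcomes, so integrability can be checked for one
    \<open>z\<close> at a time.\<close>
  define \<tau> where "\<tau> z \<omega> = 1 / real (N_switch G T N (curry z)) *
    (\<Sum>(g, t)\<in>switching_cells G T (curry z). \<Sum>i=1..N g t. Y i g t 1 \<omega> - Y i g t 0 \<omega>)" for z \<omega>
  define w where "w d e t g z = 1 / real (N_switch G T N (curry z)) * contrast G N (curry z) d e t g"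
    for d e t g z
  \<comment> \<open>The part of the estimation error that comes from changes of
    \<open>Y(d)\<close>.\<close>
  define B where "B d e \<omega> = (\<Sum>t=2..T. \<Sum>g=1..G. w (real d) e t g (Z \<omega>) * u d g t \<omega>)" for d e \<omega>

  \<comment> \<open>Finite range of the treatment vector\<close>
  have X_simple: "simple_function M (?X g t)" if "g \<in> {1..G}" "t \<in> {1..T}" for g t
    using that D_measurable D_binary
    by (intro simple_function_cell_treatment simple_function_binary)
  have X_borel: "?X g t \<in> borel_measurable M" and X_finite: "finite (?X g t ` space M)"
    if "g \<in> {1..G}" "t \<in> {1..T}" for g t
    using X_simple[OF that] by (auto intro: borel_measurable_simple_function simple_functionD)
  have R: "finite R"
    unfolding R_def Z_def using X_finite by (intro finite_range_restrict) auto
  have Z: "Z \<in> M \<rightarrow>\<^sub>M count_space R"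
    unfolding R_def Z_def[abs_def] using X_finite X_borel
    by (intro measurable_restrict_count_space) auto
  have curry_Z: "curry (Z \<omega>) g t = ?X g t \<omega>" if "g \<in> {1..G}" "t \<in> {1..T}" for g t \<omega>
    using that by (simp add: Z_def)

  \<comment> \<open>Integrability of outcomes and their changes\<close>
  have y_int: "integrable M (y d g t)" if "d \<in> {0, 1}" "g \<in> {1..G}" "t \<in> {1..T}" for d g t
    unfolding y_def cell_mean_def[abs_def] using Y_integrable that
    by (intro integrable_divide Bochner_Integration.integrable_sum) auto
  have u_int: "integrable M (u d g t)" if "d \<in> {0, 1}" "g \<in> {1..G}" "t \<in> {2..T}" for d g t
    unfolding u_def using that by (intro Bochner_Integration.integrable_diff y_int) auto
  have outcome_int: "integrable M (cell_outcome N D Y g t)" if gt: "g \<in> {1..G}" "t \<in> {1..T}" for g t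
  proof -
    \<comment> \<open>The binary treatment \<open>D i g t\<close> selects one of two integrable
      potential outcomes.\<close>
    have "integrable M (observed D Y i g t)" if "i \<in> {1..N g t}" for i
      unfolding observed_def[abs_def]
    proof (rule integrable_finite_selection[where R = "{0, 1}" and Z = "D i g t" and f = "Y i g t"])
      have "D i g t \<in> space M \<rightarrow> {0, 1}"
        using D_binary[OF gt that] by (intro Pi_I)
      then show "D i g t \<in> M \<rightarrow>\<^sub>M count_space {0, 1}"
        using D_measurable[OF gt that] by (auto simp: measurable_def)
    qed (use Y_integrable gt that in auto)
    then show ?thesis
      unfolding cell_mean_def[abs_def]
      by (intro integrable_divide Bochner_Integration.integrable_sum) auto
  qed

  \<comment> \<open>Mean zero of the estimation error\<close>
  have u_cond: "AE \<omega> in M. cond_exp_given M ?I (\<lambda>(h, s). ?X h s) (u d g t) \<omega> = \<psi> d t"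
    if d: "d \<in> {0, 1}" and g: "g \<in> {1..G}" and t: "t \<in> {2..T}" for d g t
  proof -
    have t': "t \<in> {1..T}" "t - 1 \<in> {1..T}"
      using t by auto
    have \<psi>: "\<psi> d t = (\<integral>\<omega>. u d g t \<omega> \<partial>M)"
      unfolding \<psi>_def u_def y_def using g by (intro common_trends d t) auto
    have "AE \<omega> in M. cond_exp_given M ?I (\<lambda>(h, s). ?X h s) (u d g t) \<omega>
      = cond_exp_given M ?I (\<lambda>(h, s). ?X h s) (y d g t) \<omega>
        - cond_exp_given M ?I (\<lambda>(h, s). ?X h s) (y d g (t - 1)) \<omega>"
      unfolding u_def using d g t' X_borel by (intro cond_exp_given_diff y_int) auto
    moreover have "AE \<omega> in M. cond_exp_given M {1..T} (?X g) (u d g t) \<omega>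
      = cond_exp_given M {1..T} (?X g) (y d g t) \<omega>
        - cond_exp_given M {1..T} (?X g) (y d g (t - 1)) \<omega>"
      unfolding u_def using d g t' X_borel by (intro cond_exp_given_diff y_int) auto
    \<comment> \<open>Mean independence at \<open>t\<close> and at \<open>t - 1\<close> passes from
      all treatments to those of group \<open>g\<close>; exogeneity then gives the unconditional
      mean change, which is \<open>\<psi> d t\<close>.\<close>
    ultimately show ?thesis
      using mean_independence[OF d g t'(1)] mean_independence[OF d g t'(2)]
        strong_exogeneity[OF d g t]
      unfolding y_def[symmetric] u_def[symmetric]
      by eventually_elim (simp add: \<psi>)
  qed
  have w_int: "integrable M (\<lambda>\<omega>. w d e t g (Z \<omega>))" for d e t g
    by (rule integrable_finite_selection[OF Z R, where f = "\<lambda>z \<omega>. w d e t g z"]) simp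
  have wu_int: "integrable M (\<lambda>\<omega>. w d' e t g (Z \<omega>) * u d g t \<omega>)"
    if "d \<in> {0, 1}" "g \<in> {1..G}" "t \<in> {2..T}" for d d' e g t
    using integrable_finite_selection[OF Z R, of "\<lambda>z \<omega>. w d' e t g z * u d g t \<omega>"] u_int[OF that]
    by simp
  have B_int: "integrable M (B d e)" if "d \<in> {0, 1}" for d e
    unfolding B_def using wu_int that by (intro Bochner_Integration.integrable_sum) auto
  have B_0: "(\<integral>\<omega>. B d e \<omega> \<partial>M) = 0" if d: "d \<in> {0, 1}" for d e
  proof -
    have wu: "(\<integral>\<omega>. w (real d) e t g (Z \<omega>) * u d g t \<omega> \<partial>M) = \<psi> d t * (\<integral>\<omega>. w (real d) e t g (Z \<omega>) \<partial>M)"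
      if "g \<in> {1..G}" "t \<in> {2..T}" for g t
      unfolding Z_def using that d X_borel X_finite
      by (intro expectation_weighted_if_mean_independent u_int u_cond) auto
    have "(\<integral>\<omega>. B d e \<omega> \<partial>M) = (\<Sum>t=2..T. \<integral>\<omega>. (\<Sum>g=1..G. w (real d) e t g (Z \<omega>) * u d g t \<omega>) \<partial>M)"
      unfolding B_def
      by (intro Bochner_Integration.integral_sum Bochner_Integration.integrable_sum wu_int d)
    also have "\<dots> = (\<Sum>t=2..T. \<Sum>g=1..G. \<integral>\<omega>. w (real d) e t g (Z \<omega>) * u d g t \<omega> \<partial>M)"
      by (intro sum.cong refl Bochner_Integration.integral_sum wu_int d)
    \<comment> \<open>\<open>\<psi> d t\<close> carries no group index, so it leaves the sum over
      groups; here common trends take effect.\<close>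
    also have "\<dots> = (\<Sum>t=2..T. \<psi> d t * (\<integral>\<omega>. (\<Sum>g=1..G. w (real d) e t g (Z \<omega>)) \<partial>M))"
      using wu w_int by (simp add: sum_distrib_left)
    also have "\<dots> = 0"
    proof (intro sum.neutral ballI)
      fix t assume "t \<in> {2..T}"
      \<comment> \<open>The factor with \<open>N_switch\<close> is the same for all groups, so the
        contrasts still cancel for each fixed \<open>z\<close>.\<close>
      then have "(\<Sum>g=1..G. w (real d) e t g z) = 0" for z
        unfolding w_def sum_distrib_left[symmetric]
        using balanced_panel by (subst sum_contrast_eq_0) auto
      then show "\<psi> d t * (\<integral>\<omega>. (\<Sum>g=1..G. w (real d) e t g (Z \<omega>)) \<partial>M) = 0"
        by simp
    qed
    finally show ?thesis .
  qed

  \<comment> \<open>Integrability of the target and of the estimator\<close>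
  have \<tau>_int: "integrable M (\<lambda>\<omega>. \<tau> (Z \<omega>) \<omega>)"
  proof (rule integrable_finite_selection[OF Z R, where f = \<tau>])
    show "integrable M (\<tau> z)" for z
      unfolding \<tau>_def using Y_integrable
      by (auto simp: switching_cells_def intro!: integrable_mult_right
          Bochner_Integration.integrable_sum Bochner_Integration.integrable_diff)
  qed
  have DID_int: "integrable M (\<lambda>\<omega>. DID_M G T N (curry (Z \<omega>)) (\<lambda>g t. cell_outcome N D Y g t \<omega>))"
  proof (rule integrable_finite_selection[OF Z R,
        where f = "\<lambda>z \<omega>. DID_M G T N (curry z) (\<lambda>g t. cell_outcome N D Y g t \<omega>)"])
    fix z
    \<comment> \<open>For fixed \<open>z\<close> the estimator is linear in the cell
      outcomes.\<close>
    have "DID_M G T N (curry z) Y' = 1 / real (N_switch G T N (curry z)) *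
      (\<Sum>t=2..T. (\<Sum>g=1..G. contrast G N (curry z) 0 1 t g * (Y' g t - Y' g (t - 1)))
        - (\<Sum>g=1..G. contrast G N (curry z) 1 0 t g * (Y' g t - Y' g (t - 1))))" for Y'
      using balanced_panel by (rule DID_M_eq_contrasts)
    then show "integrable M (\<lambda>\<omega>. DID_M G T N (curry z) (\<lambda>g t. cell_outcome N D Y g t \<omega>))"
      by (simp only:) (intro integrable_mult_right Bochner_Integration.integrable_sum
          Bochner_Integration.integrable_diff outcome_int; auto)
  qed

  \<comment> \<open>Almost sure decomposition of the estimator\<close>
  have decomposition: "AE \<omega> in M. DID_M G T N (curry (Z \<omega>)) (\<lambda>g t. cell_outcome N D Y g t \<omega>)
    = \<tau> (Z \<omega>) \<omega> + (B 0 1 \<omega> - B 1 0 \<omega>)"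
    using sharp_design stable_groups AE_space
  proof eventually_elim
    case (elim \<omega>)
    have obs: "real (D i g t \<omega>) = ?X g t \<omega>" if "g \<in> {1..G}" "t \<in> {1..T}" "i \<in> {1..N g t}" for i g t
      using elim(1) that by blast
    have out: "cell_outcome N D Y g t \<omega> = y d g t \<omega>"
      if gt: "g \<in> {1..G}" "t \<in> {1..T}" and "curry (Z \<omega>) g t = real d" for d g t
    proof -
      \<comment> \<open>Sharp design gives every observation the treatment of its cell, so the whole
        cell reveals the same potential outcome.\<close>
      have "D i g t \<omega> = d" if "i \<in> {1..N g t}" for i
        using obs[OF gt that] curry_Z[OF gt] \<open>curry (Z \<omega>) g t = real d\<close> by simp
      then show ?thesis
        by (simp add: y_def cell_mean_def observed_def)
    qed
    have stable: "trans_groups G (curry (Z \<omega>)) d d t \<noteq> {}"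
      if t: "t \<in> {2..T}" and movers: "trans_groups G (curry (Z \<omega>)) e d t \<noteq> {}"
        and de: "(d, e) \<in> {(0, 1), (1, 0)}"
      for d e t
    proof -
      have "t \<in> {1..T}" "t - 1 \<in> {1..T}"
        using t by auto
      then have X: "curry (Z \<omega>) g t = ?X g t \<omega>" "curry (Z \<omega>) g (t - 1) = ?X g (t - 1) \<omega>"
        if "g \<in> {1..G}" for g
        using that by (auto intro: curry_Z simp del: curry_conv)
      obtain g where "g \<in> {1..G}" "?X g t \<omega> = e" "?X g (t - 1) \<omega> = d"
        using movers X unfolding trans_groups_def by (auto simp del: curry_conv)
      then obtain g' where "g' \<in> {1..G}" "?X g' t \<omega> = d" "?X g' (t - 1) \<omega> = d"
        using elim(2) t de by blast
      then have "g' \<in> trans_groups G (curry (Z \<omega>)) d d t"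
        using X[of g'] by (simp add: trans_groups_def del: curry_conv)
      then show ?thesis
        by blast
    qed
    have "DID_M G T N (curry (Z \<omega>)) (\<lambda>g t. cell_outcome N D Y g t \<omega>) =
      1 / real (N_switch G T N (curry (Z \<omega>))) *
        (\<Sum>(g, t)\<in>switching_cells G T (curry (Z \<omega>)). real (N g t) * (y 1 g t \<omega> - y 0 g t \<omega>))
      + 1 / real (N_switch G T N (curry (Z \<omega>))) *
        (\<Sum>t=2..T. (\<Sum>g=1..G. contrast G N (curry (Z \<omega>)) 0 1 t g * (y 0 g t \<omega> - y 0 g (t - 1) \<omega>))
          - (\<Sum>g=1..G. contrast G N (curry (Z \<omega>)) 1 0 t g * (y 1 g t \<omega> - y 1 g (t - 1) \<omega>)))"
    proof (rule DID_M_decomposition[OF balanced_panel])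
      fix g t assume gt: "g \<in> {1..G}" "t \<in> {1..T}"
      \<comment> \<open>A positive cell size supplies observation 1, whose binary treatment equals
        the cell average.\<close>
      then have i: "1 \<in> {1..N g t}"
        using balanced_panel[OF gt] by simp
      show "curry (Z \<omega>) g t \<in> {0, 1}"
        using D_binary[OF gt i elim(3)] obs[OF gt i] unfolding curry_Z[OF gt] by auto
    qed (use out[of _ _ 0] out[of _ _ 1] stable in \<open>simp_all del: curry_conv\<close>)
    \<comment> \<open>Multiplying by the positive cell size undoes the averaging within
      cells.\<close>
    also have "(\<Sum>(g, t)\<in>switching_cells G T (curry (Z \<omega>)). real (N g t) * (y 1 g t \<omega> - y 0 g t \<omega>))
      = (\<Sum>(g, t)\<in>switching_cells G T (curry (Z \<omega>)). \<Sum>i=1..N g t. Y i g t 1 \<omega> - Y i g t 0 \<omega>)"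
    proof (intro sum.cong refl, clarify)
      fix g t assume "(g, t) \<in> switching_cells G T (curry (Z \<omega>))"
      then have "N g t > 0"
        using balanced_panel[of g t] by (auto simp: switching_cells_def)
      then show "real (N g t) * (y 1 g t \<omega> - y 0 g t \<omega>) = (\<Sum>i=1..N g t. Y i g t 1 \<omega> - Y i g t 0 \<omega>)"
        by (simp add: y_def cell_mean_def sum_subtractf right_diff_distrib)
    qed
    finally show ?case
      by (simp add: \<tau>_def B_def w_def u_def sum_subtractf right_diff_distrib sum_distrib_left mult.assoc
          del: curry_conv)
  qed

  \<comment> \<open>Taking expectations\<close>
  have "(\<integral>\<omega>. DID_M G T N (\<lambda>g t. ?X g t \<omega>) (\<lambda>g t. cell_outcome N D Y g t \<omega>) \<partial>M)
    = (\<integral>\<omega>. DID_M G T N (curry (Z \<omega>)) (\<lambda>g t. cell_outcome N D Y g t \<omega>) \<partial>M)"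
    by (intro Bochner_Integration.integral_cong refl DID_M_cong curry_Z[symmetric])
  also have "\<dots> = (\<integral>\<omega>. \<tau> (Z \<omega>) \<omega> + (B 0 1 \<omega> - B 1 0 \<omega>) \<partial>M)"
    using DID_int \<tau>_int B_int decomposition by (intro integral_cong_AE) auto
  also have "\<dots> = (\<integral>\<omega>. \<tau> (Z \<omega>) \<omega> \<partial>M)"
    using \<tau>_int B_int B_0 by simp
  also have "\<dots> = delta_S M G T N D Y"
  proof -
    \<comment> \<open>The integrand of \<open>delta_S\<close> sees treatments only through the
      switching cells, hence it equals \<open>\<tau> (Z \<omega>) \<omega>\<close>
      pointwise.\<close>
    have "switching_cells G T (curry (Z \<omega>)) = switching_cells G T (\<lambda>g t. ?X g t \<omega>)" for \<omega>
      by (rule switching_cells_cong) (rule curry_Z)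
    then show ?thesis
      by (simp only: delta_S_def \<tau>_def N_switch_def)
  qed
  finally show ?thesis .
qed

end
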